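(* Let $\mathbb{F}$ be a field and $X=\{x_1,\ldots,x_n\}$ a set of noncommuting variables. For $f,g\in\mathbb{F}\langle X\rangle$ we have $B(f\circ g)\le B(f)\,B(g)$.
   Context: $\mathbb{F}\langle X\rangle$ is the free noncommutative polynomial ring over $\mathbb{F}$ generated by $X$. Its elements are finite $\mathbb{F}$-linear combinations of words (monomials) over $X$. Hadamard product: for $f=\sum_m a_m m$ and $g=\sum_m b_m m$ (sums over monomials $m$), $f\circ g=\sum_m a_m b_m m$. $B(f)$ denotes the (noncommutative) algebraic branching program (ABP) complexity of $f$, i.e. the minimum size of an ABP computing $f$. An ABP over $\mathbb{F}$ and variables $x_1,\ldots,x_n$ is a layered directed acyclic graph with layers $0,1,\ldots,d$, one source vertex of indegree zero and one sink vertex of outdegree zero, which are the unique layer-$0$ and layer-$d$ vertices, respectively. Edges only go from layer $i$ to layer $i+1$, and each edge is labeled with a linear form over $\mathbb{F}$ in the variables. Each source-to-sink path computes the product of the linear forms labeling its edges (in path order), and the polynomial computed by the ABP is the sum of these products over all source-to-sink paths. The size of the ABP is its number of vertices. *)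

theory Defs
  imports
    "HOL-Library.Poly_Mapping"
    "HOL-Library.Extended_Nat"
    "Graph_Theory.Digraph"
    "Graph_Theory.Arc_Walk"
begin

text \<open>
  Words form the free monoid under concatenation, written additively because the
  convolution product of \<^type>\<open>poly_mapping\<close> is defined over additive monoids.
  Concatenation is not commutative, so neither is the resulting polynomial ring.
\<close>

instantiation list :: (type) monoid_add
begin

definition zero_list :: "'a list" where
  "zero_list = []"

definition plus_list :: "'a list \<Rightarrow> 'a list \<Rightarrow> 'a list" where
  "plus_list = append"

instance
  by standard (simp_all add: zero_list_def plus_list_def)

end

text \<open>
  The free noncommutative polynomial ring, as the monoid algebra of the words over
  the variables \<open>'x\<close>. Variables are an index type, so \<open>CARD('x)\<close> is their number.
\<close>

type_synonym ('x, 'a) ncpoly = "'x list \<Rightarrow>\<^sub>0 'a"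

lift_definition hadamard ::
    "('x, 'a :: field) ncpoly \<Rightarrow> ('x, 'a) ncpoly \<Rightarrow> ('x, 'a) ncpoly" (infixl "\<circ>\<^sub>H" 70)
  is "\<lambda>f g m. f m * g m"
  by (rule finite_subset) auto

text \<open>Linear forms are homogeneous: there is no constant term.\<close>

definition linear_form :: "('x :: finite, 'a :: field) ncpoly \<Rightarrow> bool" where
  "linear_form l \<longleftrightarrow> (\<exists>c. l = (\<Sum>x\<in>UNIV. Poly_Mapping.single [x] (c x)))"

record (overloaded) ('v, 'e, 'x, 'a) abp =
  abp_graph :: "('v, 'e) pre_digraph"
  layer :: "'v \<Rightarrow> nat"
  depth :: nat
  source :: 'v
  sink :: 'v
  label :: "'e \<Rightarrow> ('x, 'a) ncpoly"

text \<open>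
  Acyclicity needs no separate clause, since every arc raises the layer by one.
  For depth \<open>0\<close> source and sink coincide, and the empty path computes \<open>1\<close>.
\<close>

definition is_abp :: "('v, 'e, 'x :: finite, 'a :: field) abp \<Rightarrow> bool" where
  "is_abp P \<longleftrightarrow>
     digraph (abp_graph P) \<and>
     (\<forall>v \<in> verts (abp_graph P). layer P v \<le> depth P) \<and>
     (\<forall>e \<in> arcs (abp_graph P).
        layer P (head (abp_graph P) e) = Suc (layer P (tail (abp_graph P) e))) \<and>
     {v \<in> verts (abp_graph P). layer P v = 0} = {source P} \<and>
     {v \<in> verts (abp_graph P). layer P v = depth P} = {sink P} \<and>
     in_degree (abp_graph P) (source P) = 0 \<and>
     out_degree (abp_graph P) (sink P) = 0 \<and>
     (\<forall>e \<in> arcs (abp_graph P). linear_form (label P e))"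

text \<open>A path is a list of arcs; a finite digraph has finitely many of them.\<close>

definition computed_poly :: "('v, 'e, 'x :: finite, 'a :: field) abp \<Rightarrow> ('x, 'a) ncpoly" where
  "computed_poly P =
     (\<Sum>p | pre_digraph.apath (abp_graph P) (source P) p (sink P). prod_list (map (label P) p))"

definition abp_size :: "('v, 'e, 'x, 'a) abp \<Rightarrow> nat" where
  "abp_size P = card (verts (abp_graph P))"

text \<open>
  Vertices and arcs are drawn from \<^typ>\<open>nat\<close>, which loses no generality since every
  finite digraph is isomorphic to one of this kind. The infimum over a nonempty set of
  \<^typ>\<open>enat\<close> is attained; over the empty set it is \<open>\<infinity>\<close>, which is thus the complexity
  of a polynomial that no program computes (such as a nonhomogeneous one).
\<close>

definition abp_complexity :: "('x :: finite, 'a :: field) ncpoly \<Rightarrow> enat" where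
  "abp_complexity f =
     (INF P \<in> {P :: (nat, nat, 'x, 'a) abp. is_abp P \<and> computed_poly P = f}.
        enat (abp_size P))"

end

theory Submission
  imports Defs
begin

text \<open>
  Since arcs carry homogeneous linear forms, a program of depth \<open>d\<close> only produces words of
  length \<open>d\<close>. If the depths agree, the layerwise product of the two programs, with the
  Hadamard products of the labels, computes the Hadamard product: its source-sink paths are
  the pairs of source-sink paths, and on products of equally many linear forms the Hadamard
  product acts factorwise. If the depths differ, the Hadamard product vanishes, and one of the
  programs has at least two vertices, which are enough to compute \<open>0\<close>.
\<close>

section \<open>Coefficients, Hadamard products and linear forms\<close>

abbreviation coeff :: "('x, 'a :: zero) ncpoly \<Rightarrow> 'x list \<Rightarrow> 'a" where
  "coeff \<equiv> Poly_Mapping.lookup"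

lemma coeff_hadamard [simp]: "coeff (f \<circ>\<^sub>H g) w = coeff f w * coeff g w"
  by (simp add: hadamard.rep_eq)

text \<open>Bilinearity, with the double sum indexed by pairs so that it can be matched later with a
  sum over pairs of walks.\<close>

lemma hadamard_sum_sum:
  "sum F A \<circ>\<^sub>H sum G B = (\<Sum>(i, j) \<in> A \<times> B. F i \<circ>\<^sub>H G j)"
  by (rule poly_mapping_eqI)
    (simp add: lookup_sum sum_product sum.cartesian_product case_prod_unfold)

lemma coeff_sum_singles:
  "coeff (\<Sum>x\<in>UNIV. Poly_Mapping.single [x :: 'x :: finite] (c x)) w =
     (case w of [x] \<Rightarrow> c x | _ \<Rightarrow> 0)"
  by (auto simp: lookup_sum lookup_single when_def split: list.split)

lemma linear_form_hadamard:
  assumes "linear_form l" "linear_form k"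
  shows "linear_form (l \<circ>\<^sub>H k)"
proof -
  obtain c d where "l = (\<Sum>x\<in>UNIV. Poly_Mapping.single [x] (c x))"
    "k = (\<Sum>x\<in>UNIV. Poly_Mapping.single [x] (d x))"
    using assms unfolding linear_form_def by blast
  then have "l \<circ>\<^sub>H k = (\<Sum>x\<in>UNIV. Poly_Mapping.single [x] (c x * d x))"
    by (intro poly_mapping_eqI) (auto simp: coeff_sum_singles split: list.split)
  then show ?thesis
    unfolding linear_form_def by (rule exI[where x = "\<lambda>x. c x * d x"])
qed

lemma coeff_single_times_Nil: "coeff (Poly_Mapping.single [x] c * p) [] = 0"
  by (simp add: times_poly_mapping.rep_eq prod_fun_def lookup_single plus_list_def when_mult)

lemma coeff_single_times_Cons:
  "coeff (Poly_Mapping.single [x] c * p) (y # w) = (c * coeff p w when x = y)"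
  by (cases "x = y")
    (simp_all add: times_poly_mapping.rep_eq prod_fun_def lookup_single plus_list_def when_mult)

lemma linear_form_times_Nil:
  assumes "linear_form l"
  shows "coeff (l * p) [] = 0"
  using assms unfolding linear_form_def
  by (auto simp: sum_distrib_right lookup_sum coeff_single_times_Nil)

text \<open>All words of \<open>l\<close> have length one, so the only splitting of
  \<open>x # w\<close> that contributes to the convolution is \<open>[x]\<close> followed by
  \<open>w\<close>.\<close>

lemma linear_form_times_Cons:
  assumes "linear_form l"
  shows "coeff (l * p) (x # w) = coeff l [x] * coeff p w"
proof -
  obtain c where "l = (\<Sum>x\<in>UNIV. Poly_Mapping.single [x] (c x))"
    using assms unfolding linear_form_def by blast
  then show ?thesis
    by (simp add: coeff_sum_singles sum_distrib_right)
      (simp add: lookup_sum coeff_single_times_Cons when_def)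
qed

text \<open>The linear factor always takes the first letter of a word, so each nonempty word splits
  in one way and coefficients multiply separately on first letter and rest; at the empty word both
  sides are 0. For arbitrary factors, the left side would contain cross terms between different
  splittings.\<close>

lemma hadamard_linear_form_times:
  assumes "linear_form l" "linear_form k"
  shows "(l * p) \<circ>\<^sub>H (k * q) = (l \<circ>\<^sub>H k) * (p \<circ>\<^sub>H q)"
proof (rule poly_mapping_eqI)
  fix w
  show "coeff ((l * p) \<circ>\<^sub>H (k * q)) w = coeff ((l \<circ>\<^sub>H k) * (p \<circ>\<^sub>H q)) w"
    by (cases w) (simp_all add: linear_form_times_Nil linear_form_times_Cons
        linear_form_hadamard assms)
qed

lemma hadamard_one_one: "1 \<circ>\<^sub>H 1 = 1"
  by (rule poly_mapping_eqI) (simp add: lookup_one when_def)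

lemma hadamard_prod_list:
  assumes "length ls = length ks" "\<forall>l\<in>set ls. linear_form l" "\<forall>k\<in>set ks. linear_form k"
  shows "prod_list ls \<circ>\<^sub>H prod_list ks = prod_list (map2 (\<circ>\<^sub>H) ls ks)"
  using assms
  by (induction ls ks rule: list_induct2) (simp_all add: hadamard_one_one hadamard_linear_form_times)

lemma coeff_prod_list_linear_forms:
  assumes "\<forall>l\<in>set ls. linear_form l" "length w \<noteq> length ls"
  shows "coeff (prod_list ls) w = 0"
  using assms
proof (induction ls arbitrary: w)
  case Nil
  then show ?case by (simp add: lookup_one zero_list_def)
next
  case (Cons l ls)
  then show ?case
    by (cases w) (simp_all add: linear_form_times_Nil linear_form_times_Cons)
qed

section \<open>Walks in a branching program\<close>

lemma is_abp_digraph: "is_abp P \<Longrightarrow> digraph (abp_graph P)"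
  by (simp add: is_abp_def)

lemma is_abp_wf_digraph: "is_abp P \<Longrightarrow> wf_digraph (abp_graph P)"
  by (rule digraph.axioms(1)[THEN fin_digraph.axioms(1)]) (rule is_abp_digraph)

lemma is_abp_layer_head:
  "is_abp P \<Longrightarrow> e \<in> arcs (abp_graph P) \<Longrightarrow>
    layer P (head (abp_graph P) e) = Suc (layer P (tail (abp_graph P) e))"
  by (simp add: is_abp_def)

lemma is_abp_layer_le: "is_abp P \<Longrightarrow> v \<in> verts (abp_graph P) \<Longrightarrow> layer P v \<le> depth P"
  by (simp add: is_abp_def)

lemma is_abp_label: "is_abp P \<Longrightarrow> e \<in> arcs (abp_graph P) \<Longrightarrow> linear_form (label P e)"
  by (simp add: is_abp_def)

lemma is_abp_source:
  assumes "is_abp P"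
  shows "source P \<in> verts (abp_graph P)" "layer P (source P) = 0"
    "v \<in> verts (abp_graph P) \<Longrightarrow> layer P v = 0 \<Longrightarrow> v = source P"
  using assms unfolding is_abp_def by blast+

lemma is_abp_sink:
  assumes "is_abp P"
  shows "sink P \<in> verts (abp_graph P)" "layer P (sink P) = depth P"
    "v \<in> verts (abp_graph P) \<Longrightarrow> layer P v = depth P \<Longrightarrow> v = sink P"
  using assms unfolding is_abp_def by blast+

abbreviation abp_awalk :: "('v, 'e, 'x, 'a) abp \<Rightarrow> 'v \<Rightarrow> 'e list \<Rightarrow> 'v \<Rightarrow> bool" where
  "abp_awalk P \<equiv> pre_digraph.awalk (abp_graph P)"

lemma abp_awalk_Nil: "abp_awalk P u [] v \<longleftrightarrow> u = v \<and> u \<in> verts (abp_graph P)"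
  by (auto simp: pre_digraph.awalk_def pre_digraph.cas.simps)

lemma abp_awalk_Cons:
  "is_abp P \<Longrightarrow> abp_awalk P u (e # p) v \<longleftrightarrow>
    e \<in> arcs (abp_graph P) \<and> u = tail (abp_graph P) e \<and> abp_awalk P (head (abp_graph P) e) p v"
  by (rule wf_digraph.awalk_Cons_iff) (rule is_abp_wf_digraph)

lemma abp_awalk_layer:
  assumes "is_abp P" "abp_awalk P u p v"
  shows "layer P v = layer P u + length p"
  using assms(2)
  by (induction p arbitrary: u)
    (auto simp: abp_awalk_Nil abp_awalk_Cons is_abp_layer_head assms(1))

text \<open>Finer than \<open>abp_awalk_layer\<close>: the layers of all visited vertices are
  needed, in order to see that no vertex repeats.\<close>

lemma abp_awalk_verts_layer:
  assumes "is_abp P" "abp_awalk P u p v"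
  shows "map (layer P) (pre_digraph.awalk_verts (abp_graph P) u p) =
    [layer P u ..< Suc (layer P u + length p)]"
  using assms(2)
proof (induction p arbitrary: u)
  case Nil
  then show ?case by (simp add: pre_digraph.awalk_verts.simps)
next
  case (Cons e p)
  then show ?case
    by (simp add: pre_digraph.awalk_verts.simps abp_awalk_Cons is_abp_layer_head assms(1)
        upt_conv_Cons del: upt_Suc)
qed

text \<open>The vertices of a walk lie on pairwise distinct layers, so they are distinct. Walks are
  preferred from here on because they satisfy a simple recursion on the list of arcs.\<close>

lemma abp_apath_iff_awalk:
  assumes "is_abp P"
  shows "pre_digraph.apath (abp_graph P) u p v \<longleftrightarrow> abp_awalk P u p v"
  unfolding pre_digraph.apath_def
  using abp_awalk_verts_layer[OF assms] by (metis distinct_map distinct_upt)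

lemma abp_awalk_labels:
  assumes "is_abp P" "abp_awalk P u p v"
  shows "\<forall>l\<in>set (map (label P) p). linear_form l"
  using assms by (auto simp: pre_digraph.awalk_def is_abp_label)

lemma source_sink_awalk_length:
  assumes "is_abp P" "abp_awalk P (source P) p (sink P)"
  shows "length p = depth P"
  using abp_awalk_layer[OF assms] by (simp add: is_abp_source is_abp_sink assms(1))

lemma computed_poly_awalks:
  assumes "is_abp P"
  shows "computed_poly P =
    (\<Sum>p | abp_awalk P (source P) p (sink P). prod_list (map (label P) p))"
  by (simp add: computed_poly_def abp_apath_iff_awalk assms)

text \<open>Each source-sink walk contributes a product of \<open>depth P\<close> linear forms,
  which makes the computed polynomial homogeneous. This settles the case of programs of different
  depths.\<close>

lemma coeff_computed_poly:
  assumes "is_abp P" "length w \<noteq> depth P"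
  shows "coeff (computed_poly P) w = 0"
  unfolding computed_poly_awalks[OF assms(1)] lookup_sum
proof (intro sum.neutral ballI)
  fix p assume "p \<in> {p. abp_awalk P (source P) p (sink P)}"
  then have p: "abp_awalk P (source P) p (sink P)" by simp
  show "coeff (prod_list (map (label P) p)) w = 0"
    by (rule coeff_prod_list_linear_forms[OF abp_awalk_labels[OF assms(1) p]])
      (simp add: source_sink_awalk_length[OF assms(1) p] assms(2))
qed

section \<open>The layerwise product of two programs\<close>

text \<open>Pairs are coded by \<open>prod_encode\<close> because \<open>abp_complexity\<close>
  ranges over programs with vertices and arcs in \<open>nat\<close>. For arcs it suffices to compare
  the layers of the tails: both heads lie one layer higher, hence again on equal layers.\<close>

definition hadamard_graph ::
    "(nat, nat, 'x, 'a) abp \<Rightarrow> (nat, nat, 'x, 'a) abp \<Rightarrow> (nat, nat) pre_digraph" where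
  "hadamard_graph P Q =
     \<lparr>verts = prod_encode ` {(u, v). u \<in> verts (abp_graph P) \<and> v \<in> verts (abp_graph Q) \<and>
        layer P u = layer Q v},
      arcs = prod_encode ` {(d, e). d \<in> arcs (abp_graph P) \<and> e \<in> arcs (abp_graph Q) \<and>
        layer P (tail (abp_graph P) d) = layer Q (tail (abp_graph Q) e)},
      tail = prod_encode \<circ> map_prod (tail (abp_graph P)) (tail (abp_graph Q)) \<circ> prod_decode,
      head = prod_encode \<circ> map_prod (head (abp_graph P)) (head (abp_graph Q)) \<circ> prod_decode\<rparr>"

definition hadamard_abp ::
    "(nat, nat, 'x, 'a :: field) abp \<Rightarrow> (nat, nat, 'x, 'a) abp \<Rightarrow> (nat, nat, 'x, 'a) abp" where
  "hadamard_abp P Q =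
     \<lparr>abp_graph = hadamard_graph P Q,
      layer = layer P \<circ> fst \<circ> prod_decode,
      depth = depth P,
      source = prod_encode (source P, source Q),
      sink = prod_encode (sink P, sink Q),
      label = (\<lambda>(d, e). label P d \<circ>\<^sub>H label Q e) \<circ> prod_decode\<rparr>"

lemma hadamard_graph_simps:
  "prod_encode (u, v) \<in> verts (hadamard_graph P Q) \<longleftrightarrow>
     u \<in> verts (abp_graph P) \<and> v \<in> verts (abp_graph Q) \<and> layer P u = layer Q v"
  "prod_encode (d, e) \<in> arcs (hadamard_graph P Q) \<longleftrightarrow>
     d \<in> arcs (abp_graph P) \<and> e \<in> arcs (abp_graph Q) \<and>
     layer P (tail (abp_graph P) d) = layer Q (tail (abp_graph Q) e)"
  "tail (hadamard_graph P Q) (prod_encode (d, e)) =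
     prod_encode (tail (abp_graph P) d, tail (abp_graph Q) e)"
  "head (hadamard_graph P Q) (prod_encode (d, e)) =
     prod_encode (head (abp_graph P) d, head (abp_graph Q) e)"
  by (auto simp: hadamard_graph_def)

lemma hadamard_abp_simps:
  "abp_graph (hadamard_abp P Q) = hadamard_graph P Q"
  "layer (hadamard_abp P Q) (prod_encode (u, v)) = layer P u"
  "depth (hadamard_abp P Q) = depth P"
  "source (hadamard_abp P Q) = prod_encode (source P, source Q)"
  "sink (hadamard_abp P Q) = prod_encode (sink P, sink Q)"
  "label (hadamard_abp P Q) (prod_encode a) = label P (fst a) \<circ>\<^sub>H label Q (snd a)"
  by (simp_all add: hadamard_abp_def case_prod_unfold)

lemma prod_code_cases: obtains u v where "n = prod_encode (u, v)"
  by (metis prod_decode_inverse surj_pair)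

lemma digraph_hadamard_graph:
  assumes "is_abp P" "is_abp Q"
  shows "digraph (hadamard_graph P Q)"
proof -
  interpret P: digraph "abp_graph P" using assms(1) by (rule is_abp_digraph)
  interpret Q: digraph "abp_graph Q" using assms(2) by (rule is_abp_digraph)
  show ?thesis
  proof
    fix a assume "a \<in> arcs (hadamard_graph P Q)"
    then show "tail (hadamard_graph P Q) a \<in> verts (hadamard_graph P Q)"
      "head (hadamard_graph P Q) a \<in> verts (hadamard_graph P Q)"
      "tail (hadamard_graph P Q) a \<noteq> head (hadamard_graph P Q) a"
      using P.no_loops
      by (cases a rule: prod_code_cases;
          auto simp: hadamard_graph_simps is_abp_layer_head assms prod_encode_eq)+
  next
    show "finite (verts (hadamard_graph P Q))"
      by (auto simp: hadamard_graph_def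
          intro!: finite_imageI finite_subset[OF _ finite_cartesian_product[OF P.finite_verts Q.finite_verts]])
    show "finite (arcs (hadamard_graph P Q))"
      by (auto simp: hadamard_graph_def
          intro!: finite_imageI finite_subset[OF _ finite_cartesian_product[OF P.finite_arcs Q.finite_arcs]])
  next
    fix a b
    assume "a \<in> arcs (hadamard_graph P Q)" "b \<in> arcs (hadamard_graph P Q)"
      "arc_to_ends (hadamard_graph P Q) a = arc_to_ends (hadamard_graph P Q) b"
    then show "a = b"
      using P.no_multi_arcs Q.no_multi_arcs
      by (cases a rule: prod_code_cases; cases b rule: prod_code_cases)
        (auto simp: hadamard_graph_simps arc_to_ends_def prod_encode_eq)
  qed
qed

text \<open>Finiteness matters, as \<open>card\<close> is also 0 on infinite sets.\<close>

lemma in_degree_zero_iff: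
  "fin_digraph G \<Longrightarrow> in_degree G v = 0 \<longleftrightarrow> (\<forall>e\<in>arcs G. head G e \<noteq> v)"
  by (auto simp: in_degree_def in_arcs_def fin_digraph.finite_arcs)

lemma out_degree_zero_iff:
  "fin_digraph G \<Longrightarrow> out_degree G v = 0 \<longleftrightarrow> (\<forall>e\<in>arcs G. tail G e \<noteq> v)"
  by (auto simp: out_degree_def out_arcs_def fin_digraph.finite_arcs)

lemma is_abp_hadamard_abp:
  assumes P: "is_abp P" and Q: "is_abp Q" and depth: "depth P = depth Q"
  shows "is_abp (hadamard_abp P Q)"
proof -
  let ?G = "hadamard_graph P Q"
  let ?R = "hadamard_abp P Q"
  have dig: "digraph ?G" using P Q by (rule digraph_hadamard_graph)
  then have fin: "fin_digraph ?G" by (rule digraph.axioms(1))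
  have le: "layer ?R v \<le> depth ?R" if "v \<in> verts ?G" for v
    using that Q depth
    by (cases v rule: prod_code_cases)
      (auto simp: hadamard_graph_simps hadamard_abp_simps is_abp_layer_le)
  have arc: "layer ?R (head ?G a) = Suc (layer ?R (tail ?G a))" "linear_form (label ?R a)"
    if "a \<in> arcs ?G" for a
    using that P Q
    by (cases a rule: prod_code_cases;
        auto simp: hadamard_graph_simps hadamard_abp_simps is_abp_layer_head
          intro!: linear_form_hadamard is_abp_label)+
  have src: "v \<in> verts ?G \<and> layer ?R v = 0 \<longleftrightarrow> v = source ?R" for v
  proof -
    obtain u w where v: "v = prod_encode (u, w)" by (rule prod_code_cases)
    show ?thesis
      using is_abp_source(1,2)[OF P] is_abp_source(3)[OF P, of u]
        is_abp_source(1,2)[OF Q] is_abp_source(3)[OF Q, of w] depth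
      by (auto simp: v hadamard_graph_simps hadamard_abp_simps prod_encode_eq)
  qed
  \<comment> \<open>A vertex pair on layer \<open>depth P\<close> has both components on that layer,
    and equality of the depths makes it the last layer of \<open>Q\<close> too.\<close>
  have snk: "v \<in> verts ?G \<and> layer ?R v = depth ?R \<longleftrightarrow> v = sink ?R" for v
  proof -
    obtain u w where v: "v = prod_encode (u, w)" by (rule prod_code_cases)
    show ?thesis
      using is_abp_sink(1,2)[OF P] is_abp_sink(3)[OF P, of u]
        is_abp_sink(1,2)[OF Q] is_abp_sink(3)[OF Q, of w] depth
      by (auto simp: v hadamard_graph_simps hadamard_abp_simps prod_encode_eq)
  qed
  have "in_degree ?G (source ?R) = 0"
    unfolding in_degree_zero_iff[OF fin]
  proof
    \<comment> \<open>The head of an arc has a successor as its layer, while the source is on layer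
      0.\<close>
    fix a assume "a \<in> arcs ?G"
    then show "head ?G a \<noteq> source ?R"
      using arc(1)[of a] src[of "head ?G a"] by auto
  qed
  moreover have "out_degree ?G (sink ?R) = 0"
    unfolding out_degree_zero_iff[OF fin]
  proof
    interpret digraph ?G by (rule dig)
    \<comment> \<open>An arc leaving the sink would end on a layer beyond the depth.\<close>
    fix a assume a: "a \<in> arcs ?G"
    then show "tail ?G a \<noteq> sink ?R"
      using arc(1)[OF a] snk[of "tail ?G a"] le[OF head_in_verts[OF a]] by auto
  qed
  ultimately show ?thesis
    unfolding is_abp_def hadamard_abp_simps(1) src snk
    by (simp add: dig le arc)
qed

lemma abp_size_hadamard_abp:
  assumes "is_abp P" "is_abp Q"
  shows "abp_size (hadamard_abp P Q) \<le> abp_size P * abp_size Q"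
proof -
  interpret P: digraph "abp_graph P" using assms(1) by (rule is_abp_digraph)
  interpret Q: digraph "abp_graph Q" using assms(2) by (rule is_abp_digraph)
  have "verts (hadamard_graph P Q) \<subseteq> prod_encode ` (verts (abp_graph P) \<times> verts (abp_graph Q))"
    by (auto simp: hadamard_graph_def)
  then have "card (verts (hadamard_graph P Q)) \<le> card (verts (abp_graph P) \<times> verts (abp_graph Q))"
    by (intro surj_card_le) auto
  then show ?thesis
    by (simp add: abp_size_def hadamard_abp_simps card_cartesian_product)
qed

text \<open>Layers need comparing only at the start, since every arc raises both by one and so
  preserves equality. For empty walks this condition is what makes the pair a vertex of the
  product.\<close>

lemma hadamard_graph_awalk:
  assumes P: "is_abp P" and Q: "is_abp Q" and "length p = length q"
  shows "pre_digraph.awalk (hadamard_graph P Q) (prod_encode (u, v)) (map prod_encode (zip p q))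
      (prod_encode (u', v')) \<longleftrightarrow>
    abp_awalk P u p u' \<and> abp_awalk Q v q v' \<and> layer P u = layer Q v"
proof -
  interpret digraph "hadamard_graph P Q" using P Q by (rule digraph_hadamard_graph)
  show ?thesis
    using \<open>length p = length q\<close>
    by (induction p q arbitrary: u v rule: list_induct2)
      (auto simp: awalk_Nil_iff awalk_Cons_iff abp_awalk_Nil abp_awalk_Cons P Q is_abp_layer_head
        hadamard_graph_simps prod_encode_eq)
qed

lemma computed_poly_hadamard_abp:
  assumes P: "is_abp P" and Q: "is_abp Q" and depth: "depth P = depth Q"
  shows "computed_poly (hadamard_abp P Q) = computed_poly P \<circ>\<^sub>H computed_poly Q"
proof -
  let ?R = "hadamard_abp P Q"
  let ?A = "{p. abp_awalk P (source P) p (sink P)}"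
  let ?B = "{q. abp_awalk Q (source Q) q (sink Q)}"
  let ?C = "{r. abp_awalk ?R (source ?R) r (sink ?R)}"
  \<comment> \<open>Zipping two walks and projecting a walk of the product are mutually inverse;
    this bijection between \<open>?A \<times> ?B\<close> and \<open>?C\<close> matches the two sums
    term by term.\<close>
  let ?enc = "\<lambda>(p, q). map prod_encode (zip p q)"
  let ?dec = "\<lambda>r. (map (fst \<circ> prod_decode) r, map (snd \<circ> prod_decode) r)"
  have enc_dec: "?enc (?dec r) = r" for r
    by (induction r) simp_all
  have len: "length p = length q" if "(p, q) \<in> ?A \<times> ?B" for p q
  proof -
    have "length p = depth P" "length q = depth Q"
      using that by (auto intro: source_sink_awalk_length P Q)
    then show ?thesis using depth by simp
  qed
  \<comment> \<open>\<open>zip\<close> truncates the longer list, so pairs of unequal length are not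
    recovered; equal depths rule them out through \<open>len\<close>.\<close>
  have dec_enc: "?dec (?enc (p, q)) = (p, q)" if "length p = length q" for p q
    using that by (induction p q rule: list_induct2) simp_all
  \<comment> \<open>The layer condition at the start holds because both sources are on layer
    0.\<close>
  have mem: "?enc (p, q) \<in> ?C \<longleftrightarrow> (p, q) \<in> ?A \<times> ?B" if "length p = length q" for p q
    by (simp add: hadamard_abp_simps hadamard_graph_awalk[OF P Q that] is_abp_source(2) P Q)
  have labels: "prod_list (map (label ?R) (?enc (p, q))) =
      prod_list (map (label P) p) \<circ>\<^sub>H prod_list (map (label Q) q)"
    if pq: "(p, q) \<in> ?A \<times> ?B" for p q
  proof -
    from pq have p: "abp_awalk P (source P) p (sink P)" and q: "abp_awalk Q (source Q) q (sink Q)"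
      by simp_all
    have "prod_list (map (label P) p) \<circ>\<^sub>H prod_list (map (label Q) q) =
        prod_list (map2 (\<circ>\<^sub>H) (map (label P) p) (map (label Q) q))"
      by (rule hadamard_prod_list[OF _ abp_awalk_labels[OF P p] abp_awalk_labels[OF Q q]])
        (simp add: len[OF pq])
    also have "map2 (\<circ>\<^sub>H) (map (label P) p) (map (label Q) q) =
        map (label ?R) (?enc (p, q))"
      by (simp add: zip_map_map hadamard_abp_simps case_prod_unfold comp_def)
    finally show ?thesis by (rule sym)
  qed
  have "(\<Sum>(p, q)\<in>?A \<times> ?B. prod_list (map (label P) p) \<circ>\<^sub>H prod_list (map (label Q) q)) =
      (\<Sum>r\<in>?C. prod_list (map (label ?R) r))"
  proof (rule sum.reindex_bij_witness[where i = ?dec and j = ?enc])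
    fix r assume r: "r \<in> ?C"
    have "length (map (fst \<circ> prod_decode) r) = length (map (snd \<circ> prod_decode) r)"
      by simp
    from mem[OF this] r show "?dec r \<in> ?A \<times> ?B"
      by (simp only: enc_dec)
    show "?enc (?dec r) = r"
      by (rule enc_dec)
  next
    fix pq assume "pq \<in> ?A \<times> ?B"
    moreover obtain p q where pq: "pq = (p, q)" by (cases pq)
    ultimately have mem': "(p, q) \<in> ?A \<times> ?B" by (simp only:)
    show "?dec (?enc pq) = pq"
      unfolding pq by (rule dec_enc[OF len[OF mem']])
    show "?enc pq \<in> ?C"
      unfolding pq mem[OF len[OF mem']] by (rule mem')
    show "prod_list (map (label ?R) (?enc pq)) =
        (case pq of (p, q) \<Rightarrow> prod_list (map (label P) p) \<circ>\<^sub>H prod_list (map (label Q) q))"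
      unfolding pq labels[OF mem'] by simp
  qed
  then show ?thesis
    unfolding computed_poly_awalks[OF P] computed_poly_awalks[OF Q]
      computed_poly_awalks[OF is_abp_hadamard_abp[OF P Q depth]] hadamard_sum_sum
    by (rule sym)
qed

section \<open>A program for the zero polynomial, and lower bounds on size\<close>

text \<open>Depth 1 rather than 0: at depth 0 the source is the sink, and the empty path would
  contribute 1.\<close>

definition zero_abp :: "(nat, nat, 'x, 'a :: field) abp" where
  "zero_abp = \<lparr>abp_graph = \<lparr>verts = {0, 1}, arcs = {}, tail = id, head = id\<rparr>,
     layer = id, depth = 1, source = 0, sink = 1, label = (\<lambda>_. 0)\<rparr>"

lemma is_abp_zero_abp: "is_abp zero_abp"
proof -
  have "digraph (abp_graph zero_abp)"
    by unfold_locales (simp_all add: zero_abp_def)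
  then show ?thesis
    by (auto simp: is_abp_def zero_abp_def in_degree_def out_degree_def in_arcs_def out_arcs_def)
qed

lemma computed_poly_zero_abp:
  "computed_poly (zero_abp :: (nat, nat, 'x :: finite, 'a :: field) abp) = 0"
proof -
  let ?Z = "zero_abp :: (nat, nat, 'x, 'a) abp"
  have "\<not> abp_awalk ?Z (source ?Z) p (sink ?Z)" for p
    \<comment> \<open>An empty walk would identify source and sink, and a nonempty one would need an
      arc.\<close>
    by (cases p)
      (simp_all only: abp_awalk_Nil abp_awalk_Cons[OF is_abp_zero_abp], simp_all add: zero_abp_def)
  then show ?thesis
    by (simp add: computed_poly_awalks is_abp_zero_abp)
qed

lemma abp_size_zero_abp: "abp_size zero_abp = 2"
  by (simp add: abp_size_def zero_abp_def)

lemma abp_size_pos: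
  assumes "is_abp P"
  shows "0 < abp_size P"
proof -
  interpret digraph "abp_graph P" using assms by (rule is_abp_digraph)
  show ?thesis
    using is_abp_source(1)[OF assms] by (auto simp: abp_size_def card_gt_0_iff)
qed

text \<open>Source and sink lie on layers 0 and \<open>depth P\<close>, so they are two distinct
  vertices.\<close>

lemma abp_size_ge_2:
  assumes "is_abp P" "depth P \<noteq> 0"
  shows "2 \<le> abp_size P"
proof -
  interpret digraph "abp_graph P" using assms(1) by (rule is_abp_digraph)
  have "source P \<noteq> sink P"
    using assms is_abp_source(2) is_abp_sink(2) by metis
  moreover have "card {source P, sink P} \<le> card (verts (abp_graph P))"
    using is_abp_source(1) is_abp_sink(1) assms(1) by (intro card_mono) auto
  ultimately show ?thesis by (simp add: abp_size_def)
qed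

section \<open>Bounding the complexity\<close>

lemma abp_complexity_le:
  fixes P :: "(nat, nat, 'x :: finite, 'a :: field) abp"
  shows "is_abp P \<Longrightarrow> computed_poly P = f \<Longrightarrow> abp_complexity f \<le> enat (abp_size P)"
  unfolding abp_complexity_def by (rule INF_lower) simp

text \<open>Well-ordering of \<open>enat\<close> lets an optimal program stand in for the infimum
  whenever some program computes \<open>f\<close>.\<close>

lemma abp_complexity_cases:
  obtains "abp_complexity f = \<infinity>"
  | P :: "(nat, nat, 'x :: finite, 'a :: field) abp"
    where "is_abp P" "computed_poly P = f" "abp_complexity f = enat (abp_size P)"
proof -
  let ?A = "(\<lambda>P. enat (abp_size P)) `
    {P :: (nat, nat, 'x, 'a) abp. is_abp P \<and> computed_poly P = f}"
  show thesis
  proof (cases "?A = {}")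
    case True
    then show thesis
      using that(1) by (simp add: abp_complexity_def Inf_enat_def del: image_is_empty)
  next
    case False
    then have "Inf ?A \<in> ?A"
      unfolding Inf_enat_def by (simp del: image_is_empty) (meson LeastI ex_in_conv)
    then show thesis
      using that(2) unfolding abp_complexity_def by blast
  qed
qed

lemma abp_complexity_hadamard_le:
  fixes P Q :: "(nat, nat, 'x :: finite, 'a :: field) abp"
  assumes P: "is_abp P" and Q: "is_abp Q"
  shows "abp_complexity (computed_poly P \<circ>\<^sub>H computed_poly Q) \<le> enat (abp_size P * abp_size Q)"
proof (cases "depth P = depth Q")
  case True
  then have "abp_complexity (computed_poly P \<circ>\<^sub>H computed_poly Q) \<le> enat (abp_size (hadamard_abp P Q))"
    by (intro abp_complexity_le is_abp_hadamard_abp computed_poly_hadamard_abp P Q)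
  also have "\<dots> \<le> enat (abp_size P * abp_size Q)"
    using abp_size_hadamard_abp[OF P Q] by simp
  finally show ?thesis .
next
  case False
  \<comment> \<open>The length of a word differs from at least one of the two depths, so one of its
    two coefficients is 0.\<close>
  have "computed_poly P \<circ>\<^sub>H computed_poly Q = 0"
    by (rule poly_mapping_eqI)
      (metis False coeff_computed_poly[OF P] coeff_computed_poly[OF Q] coeff_hadamard
        lookup_zero mult_eq_0_iff)
  then have "abp_complexity (computed_poly P \<circ>\<^sub>H computed_poly Q) \<le> enat 2"
    using abp_complexity_le[OF is_abp_zero_abp computed_poly_zero_abp]
    by (simp add: abp_size_zero_abp)
  \<comment> \<open>The depths differ, so one of them is nonzero; that program has at least two
    vertices and the other at least one.\<close>
  also have "2 \<le> abp_size P * abp_size Q"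
    using False abp_size_pos[OF P] abp_size_pos[OF Q] abp_size_ge_2[OF P] abp_size_ge_2[OF Q]
      mult_le_mono[of 2 "abp_size P" 1 "abp_size Q"] mult_le_mono[of 1 "abp_size P" 2 "abp_size Q"]
    by (cases "depth P = 0") auto
  finally show ?thesis by simp
qed

text \<open>In \<open>enat\<close> the product of 0 and \<infinity> is 0. Excluding 0 ensures that
  the bound is \<infinity> as soon as one of the two polynomials has no program.\<close>

lemma abp_complexity_neq_0: "abp_complexity f \<noteq> 0"
proof (cases f rule: abp_complexity_cases)
  case (2 P)
  then show ?thesis
    using abp_size_pos[OF 2(1)] by (simp add: enat_0_iff)
qed simp

theorem lemma1:
  fixes f g :: "('x :: finite, 'a :: field) ncpoly"
  shows "abp_complexity (f \<circ>\<^sub>H g) \<le> abp_complexity f * abp_complexity g"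
proof (cases f rule: abp_complexity_cases)
  case 1
  then show ?thesis
    using abp_complexity_neq_0[of g] by (simp add: imult_infinity)
next
  case P: (2 P)
  show ?thesis
  proof (cases g rule: abp_complexity_cases)
    case 1
    then show ?thesis
      using abp_complexity_neq_0[of f] by (simp add: imult_infinity_right)
  next
    case Q: (2 Q)
    then show ?thesis
      using abp_complexity_hadamard_le[OF P(1) Q(1)] P by simp
  qed
qed

end
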